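(* Let $(A,(p_s)_{s\in S})$ be a weakly regular locally convex algebra with unit, satisfying property (P). Let $B$ be a locally multiplicatively convex algebra, and let $\phi:A\to B$ be a one-to-one algebra homomorphism such that $C=\overline{\operatorname{Im}\phi}$ (the closure of $\operatorname{Im}\phi$ in $B$) is a semisimple Q-algebra. If $A$ is functionally continuous, then $\phi^{-1}:\operatorname{Im}\phi\to A$ is continuous (where $\operatorname{Im}\phi$ carries the topology induced by $B$).
   Context: A topological algebra is an (associative, not necessarily commutative) algebra over $\mathbb{C}$ which is also a Hausdorff topological vector space such that the multiplication is separately continuous. A locally convex algebra $(A,(p_s)_{s\in S})$ is a topological algebra whose topology is locally convex, determined by the family of seminorms $(p_s)_{s\in S}$; a locally multiplicatively convex algebra is a topological algebra whose topology is determined by a family of submultiplicative seminorms. $M^*(A)$ denotes the set of all nonzero multiplicative linear functionals $A\to\mathbb{C}$, and $M(A)$ the subset of the continuous ones, endowed with the weak-$*$ (Gelfand) topology of pointwise convergence on $A$. $A$ is functionally continuous if $M^*(A)=M(A)$. $A$ is weakly regular if for every closed subset $F\subset M(A)$ with $F\neq M(A)$, there exists a nonzero $x\in A$ such that $f(x)=0$ for all $f\in F$. $(A,(p_s)_{s\in S})$ satisfies property (P) if $M^*(A)\ne\emptyset$ and for all $x\in A$ and every $s\in S$ with $p_s(x)=1$, there exists $f_0\in M^*(A)$ such that $|f_0(x)|\ge 1$. A topological algebra is a Q-algebra if the set of its quasi-invertible elements is open, where $x$ is quasi-invertible if there is $y$ with $x+y+xy=0=x+y+yx$. Semisimple means that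 the Jacobson radical is zero. *)

theory Defs
  imports "HOL-Analysis.Analysis"
begin

text \<open>
  The library has no class of complex algebras, so the complex scalar multiplication is an
  explicit parameter \<open>sc\<close>; the ring structure and the Hausdorff topology come from the
  type classes \<open>ring\<close> (associative, neither commutative nor unital) and \<open>t2_space\<close>.
\<close>

locale complex_algebra = vector_space sc
  for sc :: "complex \<Rightarrow> 'a::ring \<Rightarrow> 'a" +
  assumes scale_mult_left: "sc c x * y = sc c (x * y)"
    and mult_scale_right: "x * sc c y = sc c (x * y)"

locale topological_algebra = complex_algebra sc
  for sc :: "complex \<Rightarrow> 'a::{ring,t2_space} \<Rightarrow> 'a" +
  assumes continuous_add: "continuous_on UNIV (\<lambda>(x::'a, y). x + y)"
    and continuous_scale: "continuous_on UNIV (\<lambda>(c, x). sc c x)"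
    and continuous_mult_left: "continuous_on UNIV (\<lambda>x::'a. a * x)"
    and continuous_mult_right: "continuous_on UNIV (\<lambda>x::'a. x * a)"

definition seminorm :: "(complex \<Rightarrow> 'a::ab_group_add \<Rightarrow> 'a) \<Rightarrow> ('a \<Rightarrow> real) \<Rightarrow> bool" where
  "seminorm sc p \<longleftrightarrow>
     (\<forall>x. 0 \<le> p x) \<and> (\<forall>x y. p (x + y) \<le> p x + p y) \<and> (\<forall>c x. p (sc c x) = norm c * p x)"

definition submultiplicative :: "('a::times \<Rightarrow> real) \<Rightarrow> bool" where
  "submultiplicative p \<longleftrightarrow> (\<forall>x y. p (x * y) \<le> p x * p y)"

text \<open>The family need not be directed, hence the finite intersections of balls.\<close>

definition topology_determined_by ::
    "'s set \<Rightarrow> ('s \<Rightarrow> 'a::{ab_group_add,topological_space} \<Rightarrow> real) \<Rightarrow> bool" where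
  "topology_determined_by S p \<longleftrightarrow>
     (\<forall>U. open U \<longleftrightarrow>
        (\<forall>x\<in>U. \<exists>F e. finite F \<and> F \<subseteq> S \<and> 0 < e \<and> {y. \<forall>s\<in>F. p s (y - x) < e} \<subseteq> U))"

locale locally_convex_algebra = topological_algebra sc
  for sc :: "complex \<Rightarrow> 'a::{ring,t2_space} \<Rightarrow> 'a"
    and S :: "'s set" and p :: "'s \<Rightarrow> 'a \<Rightarrow> real" +
  assumes seminorms: "s \<in> S \<Longrightarrow> seminorm sc (p s)"
    and determined: "topology_determined_by S p"

text \<open>A family is only asserted to exist here, so it may be taken as a set indexed by itself.\<close>

locale locally_m_convex_algebra = topological_algebra sc
  for sc :: "complex \<Rightarrow> 'a::{ring,t2_space} \<Rightarrow> 'a" +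
  assumes determined_submultiplicative:
    "\<exists>Q. (\<forall>q\<in>Q. seminorm sc q \<and> submultiplicative q) \<and> topology_determined_by Q (\<lambda>q. q)"

definition algebra_hom ::
    "(complex \<Rightarrow> 'a::ring \<Rightarrow> 'a) \<Rightarrow> (complex \<Rightarrow> 'b::ring \<Rightarrow> 'b) \<Rightarrow> ('a \<Rightarrow> 'b) \<Rightarrow> bool" where
  "algebra_hom sA sB h \<longleftrightarrow> Vector_Spaces.linear sA sB h \<and> (\<forall>x y. h (x * y) = h x * h y)"

definition characters :: "(complex \<Rightarrow> 'a::ring \<Rightarrow> 'a) \<Rightarrow> ('a \<Rightarrow> complex) set" where
  "characters sc = {f. algebra_hom sc (*) f \<and> (\<exists>x. f x \<noteq> 0)}"

definition continuous_characters ::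
    "(complex \<Rightarrow> 'a::{ring,topological_space} \<Rightarrow> 'a) \<Rightarrow> ('a \<Rightarrow> complex) set" where
  "continuous_characters sc = {f \<in> characters sc. continuous_on UNIV f}"

definition functionally_continuous ::
    "(complex \<Rightarrow> 'a::{ring,topological_space} \<Rightarrow> 'a) \<Rightarrow> bool" where
  "functionally_continuous sc \<longleftrightarrow> characters sc = continuous_characters sc"

text \<open>
  The library topology on a function type is that of pointwise convergence, so
  \<open>top_of_set (continuous_characters sc)\<close> carries the Gelfand topology.
\<close>

definition weakly_regular ::
    "(complex \<Rightarrow> 'a::{ring,topological_space} \<Rightarrow> 'a) \<Rightarrow> bool" where
  "weakly_regular sc \<longleftrightarrow>
     (\<forall>F. closedin (top_of_set (continuous_characters sc)) F \<and> F \<noteq> continuous_characters sc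
        \<longrightarrow> (\<exists>x. x \<noteq> 0 \<and> (\<forall>f\<in>F. f x = 0)))"

definition property_P ::
    "(complex \<Rightarrow> 'a::ring \<Rightarrow> 'a) \<Rightarrow> 's set \<Rightarrow> ('s \<Rightarrow> 'a \<Rightarrow> real) \<Rightarrow> bool" where
  "property_P sc S p \<longleftrightarrow>
     characters sc \<noteq> {} \<and>
     (\<forall>x. \<forall>s\<in>S. p s x = 1 \<longrightarrow> (\<exists>f\<in>characters sc. norm (f x) \<ge> 1))"

text \<open>
  The notions below concern a subalgebra \<open>C\<close> of the ambient type, regarded as an algebra in its
  own right: quasi-inverses and ideals are taken inside \<open>C\<close>, with the subspace topology.
\<close>

definition quasi_invertibles :: "'a::ring set \<Rightarrow> 'a set" where
  "quasi_invertibles C = {x \<in> C. \<exists>y\<in>C. x + y + x * y = 0 \<and> x + y + y * x = 0}"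

definition Q_algebra :: "'a::{ring,topological_space} set \<Rightarrow> bool" where
  "Q_algebra C \<longleftrightarrow> openin (top_of_set C) (quasi_invertibles C)"

definition left_ideal :: "(complex \<Rightarrow> 'a::ring \<Rightarrow> 'a) \<Rightarrow> 'a set \<Rightarrow> 'a set \<Rightarrow> bool" where
  "left_ideal sc C I \<longleftrightarrow>
     I \<subseteq> C \<and> module.subspace sc I \<and> (\<forall>c\<in>C. \<forall>x\<in>I. c * x \<in> I)"

definition modular :: "'a::ring set \<Rightarrow> 'a set \<Rightarrow> bool" where
  "modular C I \<longleftrightarrow> (\<exists>u\<in>C. \<forall>x\<in>C. x - x * u \<in> I)"

definition maximal_left_ideal :: "(complex \<Rightarrow> 'a::ring \<Rightarrow> 'a) \<Rightarrow> 'a set \<Rightarrow> 'a set \<Rightarrow> bool" where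
  "maximal_left_ideal sc C I \<longleftrightarrow>
     left_ideal sc C I \<and> I \<noteq> C \<and>
     (\<forall>J. left_ideal sc C J \<and> I \<subseteq> J \<and> J \<noteq> C \<longrightarrow> J = I)"

text \<open>
  An algebra need not have a unit, so the Jacobson radical is the intersection of the maximal
  modular left ideals; it is the whole algebra if there are none.
\<close>

definition jacobson_radical :: "(complex \<Rightarrow> 'a::ring \<Rightarrow> 'a) \<Rightarrow> 'a set \<Rightarrow> 'a set" where
  "jacobson_radical sc C =
     {x \<in> C. \<forall>I. maximal_left_ideal sc C I \<and> modular C I \<longrightarrow> x \<in> I}"

definition semisimple :: "(complex \<Rightarrow> 'a::ring \<Rightarrow> 'a) \<Rightarrow> 'a set \<Rightarrow> bool" where
  "semisimple sc C \<longleftrightarrow> jacobson_radical sc C = {0}"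

end

theory Submission
  imports Defs
begin

text \<open>
  Since \<open>C\<close> is a Q-algebra, there are a continuous submultiplicative seminorm \<open>q\<close> on \<open>B\<close> and \<open>\<epsilon> > 0\<close> such
  that every \<open>y \<in> C\<close> with \<open>q y < \<epsilon>\<close> is quasi-invertible. Property (P) makes the characters separate the
  points of \<open>A\<close>, so \<open>A\<close> and hence \<open>C\<close> are commutative. By Gelfand--Mazur every maximal ideal of \<open>C\<close> is the
  kernel of a character \<open>g\<close> with \<open>\<epsilon> * norm (g y) \<le> q y\<close>. The characters \<open>f\<close> of \<open>A\<close> with
  \<open>\<epsilon> * norm (f x) \<le> q (\<phi> x)\<close> form a closed set containing all pullbacks of such \<open>g\<close>, so an \<open>x\<close> killed by
  that set is mapped into the radical of \<open>C\<close> and vanishes. By weak regularity the set is all of \<open>M(A)\<close>,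
  and (P) turns the bound on characters into \<open>\<epsilon> * p\<^sub>s x \<le> q (\<phi> x)\<close>.
\<close>

section \<open>Elementary properties of seminorms on complex algebras\<close>

context complex_algebra
begin

lemma seminorm_nonneg: "seminorm sc N \<Longrightarrow> 0 \<le> N x"
  by (simp add: seminorm_def)

lemma seminorm_triangle: "seminorm sc N \<Longrightarrow> N (x + y) \<le> N x + N y"
  by (simp add: seminorm_def)

lemma seminorm_scale: "seminorm sc N \<Longrightarrow> N (sc c x) = norm c * N x"
  by (simp add: seminorm_def)

lemma seminorm_zero: "seminorm sc N \<Longrightarrow> N 0 = 0"
  using seminorm_scale[of N 0 0] by simp

lemma seminorm_minus: "seminorm sc N \<Longrightarrow> N (- x) = N x"
  using seminorm_scale[of N "-1" x] by simp

lemma seminorm_diff: "seminorm sc N \<Longrightarrow> N (x - y) \<le> N x + N y"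
  using seminorm_triangle[of N x "- y"] by (simp add: seminorm_minus)

lemma seminorm_sum:
  assumes "seminorm sc N"
  shows "N (sum f A) \<le> (\<Sum>i\<in>A. N (f i))"
proof (induction A rule: infinite_finite_induct)
  case (insert x F)
  then show ?case using seminorm_triangle[OF assms, of "f x" "sum f F"] by simp
qed (simp_all add: seminorm_zero[OF assms])

text \<open>
  A discretised mean value property. Between neighbouring circles of a polar grid the sum of the
  values of \<open>R\<close> changes by the step size times \<open>\<Sum>\<^sub>j w\<^sup>j D (r w\<^sup>j)\<close> up to second order; the latter sum is
  itself small, because the increments of \<open>R\<close> around a circle telescope to zero.
\<close>

lemma seminorm_center_le_circle:
  fixes R D :: "complex \<Rightarrow> 'a"
  assumes N: "seminorm sc N" and \<rho>: "0 < \<rho>"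
    and taylor: "\<And>u v. norm u \<le> \<rho> \<Longrightarrow> norm v \<le> \<rho> \<Longrightarrow>
                   N (R v - R u - sc (v - u) (D u)) \<le> K * (norm (v - u))\<^sup>2"
    and circle: "\<And>u. norm u = \<rho> \<Longrightarrow> N (R u) \<le> b"
  shows "N (R 0) \<le> b"
proof -
  \<comment> \<open>The Taylor bound from 0 to \<rho> has a nonnegative left side.
    \<open>0 \<le> K\<close> is used when \<open>h * real i\<close> is enlarged to
    \<open>\<rho>\<close> in the angular estimate.\<close>
  have "0 \<le> K * \<rho>\<^sup>2"
    using taylor[of 0 "of_real \<rho>"] seminorm_nonneg[OF N] \<rho> by (fastforce intro: order_trans)
  then have K: "0 \<le> K" using \<rho> by (simp add: zero_le_mult_iff)
  define w where "w n = cis (2 * pi / real n)" for n :: nat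
  define d where "d n = norm (w n - 1)" for n
  \<comment> \<open>The term \<open>1 / real n\<close> collects the radial Taylor errors,
    \<open>d n\<close> the angular ones. From \<open>n \<ge> 2\<close> on, \<open>w n\<close>
    differs from 1.\<close>
  have est: "N (R 0) \<le> b + K * \<rho>\<^sup>2 * (1 / real n + d n)" if n: "n \<ge> 2" for n
  proof -
    define h where "h = \<rho> / real n"
    \<comment> \<open>Polar grid with \<open>n\<close> circles and \<open>n\<close> rays: circle 0
      collapses to the centre, so \<open>S 0\<close> is \<open>n\<close> times \<open>R 0\<close>,
      and circle \<open>n\<close> is the boundary circle.\<close>
    define z where "z i j = of_real (h * real i) * w n ^ j" for i j :: nat
    define S where "S i = (\<Sum>j<n. R (z i j))" for i
    define E where "E i = (\<Sum>j<n. sc (w n ^ j) (D (z i j)))" for i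
    have h: "0 < h" "h * real n = \<rho>" using \<rho> n by (auto simp: h_def)
    have nw: "norm (w n) = 1" by (simp add: w_def)
    have nz: "norm (z i j) = h * real i" for i j
      using h by (simp add: z_def norm_mult norm_power nw)
    have nz_le: "norm (z i j) \<le> \<rho>" if "i \<le> n" for i j
      using that h by (metis nz mult_left_mono of_nat_mono less_imp_le)
    have wn: "w n ^ n = 1" unfolding w_def Complex.DeMoivre using n by simp
    have w1: "w n \<noteq> 1"
    proof
      assume "w n = 1"
      then have "cos (2 * pi / real n) = 1" by (simp add: w_def complex_eq_iff)
      moreover have "0 < 2 * pi / real n" "2 * pi / real n \<le> pi" using n by (auto simp: field_simps)
      then have "cos (2 * pi / real n) < cos 0" by (intro cos_monotone_0_pi) auto
      ultimately show False by simp
    qed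
    then have d: "0 < d n" by (simp add: d_def)
    \<comment> \<open>Taylor expansion at the outer endpoint of each radial segment; the
      displacements \<open>- h * w n ^ j\<close> assemble the linear terms into a multiple of
      \<open>E (Suc i)\<close>.\<close>
    have radial: "N (S i - S (Suc i) - sc (- of_real h) (E (Suc i))) \<le> real n * (K * h\<^sup>2)"
      if "i < n" for i
    proof -
      have diff: "z i j - z (Suc i) j = - of_real h * w n ^ j" for j
        by (simp add: z_def algebra_simps)
      have ndiff: "norm (z i j - z (Suc i) j) = h" for j
        using h by (simp add: diff norm_mult norm_power nw)
      have "S i - S (Suc i) - sc (- of_real h) (E (Suc i)) =
          (\<Sum>j<n. R (z i j) - R (z (Suc i) j) - sc (z i j - z (Suc i) j) (D (z (Suc i) j)))"
        unfolding diff S_def E_def by (simp add: sum_subtractf scale_sum_right del: scale_minus_left)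
      then have "N (S i - S (Suc i) - sc (- of_real h) (E (Suc i))) = N \<dots>"
        by (rule arg_cong)
      also have "\<dots> \<le> (\<Sum>j<n. N (R (z i j) - R (z (Suc i) j) - sc (z i j - z (Suc i) j) (D (z (Suc i) j))))"
        by (rule seminorm_sum[OF N])
      also have "\<dots> \<le> (\<Sum>j<n. K * h\<^sup>2)"
      proof (rule sum_mono)
        fix j
        show "N (R (z i j) - R (z (Suc i) j) - sc (z i j - z (Suc i) j) (D (z (Suc i) j))) \<le> K * h\<^sup>2"
          using taylor[OF nz_le nz_le, of "Suc i" i j j] that by (simp only: ndiff Suc_leI less_imp_le)
      qed
      finally show ?thesis by simp
    qed
    \<comment> \<open>Taylor expansion along the circle: as \<open>w n ^ n = 1\<close>, the
      increments of \<open>R\<close> cancel and only the linear terms, a multiple of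
      \<open>E i\<close>, and the errors remain. Dividing by the step length requires
      \<open>0 < i\<close>.\<close>
    have angular: "N (E i) \<le> real n * (K * \<rho> * d n)" if i: "0 < i" "i \<le> n" for i
    proof -
      have diff: "z i (Suc j) - z i j = of_real (h * real i) * (w n - 1) * w n ^ j" for j
        by (simp add: z_def algebra_simps)
      have ndiff: "norm (z i (Suc j) - z i j) = h * real i * d n" for j
        using h by (simp add: diff norm_mult norm_power nw d_def)
      have nscale: "norm (of_real (h * real i) * (w n - 1)) = h * real i * d n"
        unfolding norm_mult norm_of_real d_def using h by simp
      have "(\<Sum>j<n. R (z i (Suc j)) - R (z i j)) = 0"
        using sum_lessThan_telescope[of "\<lambda>j. R (z i j)" n] by (simp add: z_def wn)
      then have "- sc (of_real (h * real i) * (w n - 1)) (E i) =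
          (\<Sum>j<n. R (z i (Suc j)) - R (z i j) - sc (z i (Suc j) - z i j) (D (z i j)))"
        unfolding diff E_def by (subst sum_subtractf) (simp add: scale_sum_right)
      then have "N (sc (of_real (h * real i) * (w n - 1)) (E i)) =
          N (\<Sum>j<n. R (z i (Suc j)) - R (z i j) - sc (z i (Suc j) - z i j) (D (z i j)))"
        by (metis seminorm_minus[OF N])
      also have "\<dots> \<le> (\<Sum>j<n. N (R (z i (Suc j)) - R (z i j) - sc (z i (Suc j) - z i j) (D (z i j))))"
        by (rule seminorm_sum[OF N])
      also have "\<dots> \<le> (\<Sum>j<n. K * (h * real i * d n)\<^sup>2)"
      proof (rule sum_mono)
        fix j
        show "N (R (z i (Suc j)) - R (z i j) - sc (z i (Suc j) - z i j) (D (z i j))) \<le> K * (h * real i * d n)\<^sup>2"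
          using taylor[OF nz_le nz_le, of i i "Suc j" j] i by (simp only: ndiff)
      qed
      finally have "(h * real i * d n) * N (E i) \<le> (h * real i * d n) * (real n * (K * (h * real i) * d n))"
        unfolding seminorm_scale[OF N] nscale by (simp add: power2_eq_square mult_ac)
      moreover have "0 < h * real i * d n" using h i d by simp
      ultimately have "N (E i) \<le> real n * (K * (h * real i) * d n)" by (simp only: mult_le_cancel_left_pos)
      also have "h * real i \<le> \<rho>" using nz_le[OF i(2)] nz by simp
      then have "real n * (K * (h * real i) * d n) \<le> real n * (K * \<rho> * d n)"
        using K d by (intro mult_left_mono mult_right_mono) auto
      finally show ?thesis .
    qed
    have step: "N (S i - S (Suc i)) \<le> real n * (K * h\<^sup>2) + h * (real n * (K * \<rho> * d n))" if "i < n" for i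
    proof -
      have "N (S i - S (Suc i)) \<le> N (S i - S (Suc i) - sc (- of_real h) (E (Suc i))) + N (sc (- of_real h) (E (Suc i)))"
        using seminorm_triangle[OF N, of "S i - S (Suc i) - sc (- of_real h) (E (Suc i))" "sc (- of_real h) (E (Suc i))"]
        by simp
      also have "\<dots> \<le> real n * (K * h\<^sup>2) + h * (real n * (K * \<rho> * d n))"
        unfolding seminorm_scale[OF N]
        using radial[OF that] angular[of "Suc i"] that h
        by (intro add_mono) (auto intro!: mult_left_mono)
      finally show ?thesis .
    qed
    have "S 0 - S n = (\<Sum>i<n. S i - S (Suc i))" by (simp add: sum_lessThan_telescope')
    then have "N (S 0 - S n) \<le> (\<Sum>i<n. N (S i - S (Suc i)))" using seminorm_sum[OF N] by metis
    also have "\<dots> \<le> (\<Sum>i<n. real n * (K * h\<^sup>2) + h * (real n * (K * \<rho> * d n)))"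
      by (rule sum_mono) (use step in auto)
    also have "\<dots> = (h * real n) * (K * (h * real n)) + (h * real n) * (real n * (K * \<rho> * d n))"
      by (simp add: power2_eq_square algebra_simps)
    also have "\<dots> = real n * (K * \<rho>\<^sup>2 * (1 / real n + d n))"
      unfolding h using n by (simp add: power2_eq_square field_simps)
    finally have 1: "N (S 0 - S n) \<le> real n * (K * \<rho>\<^sup>2 * (1 / real n + d n))" .
    have "N (S n) \<le> (\<Sum>j<n. N (R (z n j)))" unfolding S_def by (rule seminorm_sum[OF N])
    also have "\<dots> \<le> (\<Sum>j<n. b)" by (rule sum_mono) (simp add: circle nz h)
    finally have 2: "N (S n) \<le> real n * b" by simp
    have "S 0 = sc (of_nat n) (R 0)"
      by (simp add: S_def z_def sum_constant_scale)
    then have "real n * N (R 0) = N (S 0)" by (simp add: seminorm_scale[OF N])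
    also have "\<dots> \<le> N (S 0 - S n) + N (S n)" using seminorm_triangle[OF N, of "S 0 - S n" "S n"] by simp
    also have "\<dots> \<le> real n * (b + K * \<rho>\<^sup>2 * (1 / real n + d n))"
      using 1 2 by (simp add: algebra_simps)
    finally show ?thesis using n by (simp only: mult_le_cancel_left_pos)
  qed
  \<comment> \<open>Refining the grid removes the error, since \<open>d n\<close> tends to
    0.\<close>
  have "(\<lambda>n. 2 * pi / real n) \<longlonglongrightarrow> 0" by (rule lim_const_over_n)
  then have "w \<longlonglongrightarrow> cis 0" unfolding w_def by (intro tendsto_cis)
  then have "d \<longlonglongrightarrow> norm (cis 0 - 1)" unfolding d_def by (intro tendsto_intros)
  then have "(\<lambda>n. b + K * \<rho>\<^sup>2 * (1 / real n + d n)) \<longlonglongrightarrow> b + K * \<rho>\<^sup>2 * (0 + 0)"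
    by (intro tendsto_intros lim_1_over_n) simp
  then have "N (R 0) \<le> b + K * \<rho>\<^sup>2 * (0 + 0)"
    by (rule LIMSEQ_le_const) (use est in blast)
  then show ?thesis by simp
qed

section \<open>Quotient seminorms\<close>

text \<open>The induced seminorm on the quotient by \<open>I\<close>, pulled back to the algebra so
  that no quotient type is formed.\<close>

definition quotient_seminorm :: "'a set \<Rightarrow> ('a \<Rightarrow> real) \<Rightarrow> 'a \<Rightarrow> real" where
  "quotient_seminorm I q y = (INF m\<in>I. q (y + m))"

lemma quotient_seminorm_le:
  assumes "seminorm sc q" "m \<in> I"
  shows "quotient_seminorm I q y \<le> q (y + m)"
  unfolding quotient_seminorm_def
  by (rule cINF_lower[OF bdd_belowI2[of _ 0] assms(2)]) (rule seminorm_nonneg[OF assms(1)])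

lemma quotient_seminorm_greatest:
  assumes "subspace I" "\<And>m. m \<in> I \<Longrightarrow> a \<le> q (y + m)"
  shows "a \<le> quotient_seminorm I q y"
  unfolding quotient_seminorm_def
  by (rule cINF_greatest) (use assms subspace_0 in blast)+

lemma quotient_seminorm_eq_0:
  assumes q: "seminorm sc q" and I: "subspace I" and y: "y \<in> I"
  shows "quotient_seminorm I q y = 0"
proof (rule antisym)
  show "quotient_seminorm I q y \<le> 0"
    using quotient_seminorm_le[OF q subspace_neg[OF I y], of y] seminorm_zero[OF q] by simp
  show "0 \<le> quotient_seminorm I q y"
    by (rule quotient_seminorm_greatest[OF I]) (rule seminorm_nonneg[OF q])
qed

text \<open>Takes the infimum over a coset in one factor of a product bound. The factor
  \<open>k\<close> may vanish, and then there is no dividing by it.\<close>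

lemma quotient_seminorm_mult_greatest:
  assumes "subspace I" "0 \<le> k" "\<And>m. m \<in> I \<Longrightarrow> a \<le> q (y + m) * k"
  shows "a \<le> quotient_seminorm I q y * k"
proof (cases "k = 0")
  case True
  then show ?thesis using assms(3)[OF subspace_0[OF assms(1)]] by simp
next
  case False
  then have "a / k \<le> quotient_seminorm I q y"
    using assms by (intro quotient_seminorm_greatest) (auto simp: divide_le_eq)
  then show ?thesis using False assms(2) by (simp add: divide_le_eq)
qed

text \<open>Translating by members of \<open>I\<close> gives subadditivity and one half of
  homogeneity; the other half is the first one applied to \<open>inverse c\<close>.\<close>

lemma seminorm_quotient_seminorm:
  assumes q: "seminorm sc q" and I: "subspace I"
  shows "seminorm sc (quotient_seminorm I q)"
proof -
  let ?N = "quotient_seminorm I q"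
  have nonneg: "0 \<le> ?N x" for x
    by (rule quotient_seminorm_greatest[OF I]) (rule seminorm_nonneg[OF q])
  have "?N (x + y) \<le> ?N x + ?N y" for x y
  proof -
    have "?N (x + y) \<le> q (x + m) + q (y + n)" if "m \<in> I" "n \<in> I" for m n
      using quotient_seminorm_le[OF q subspace_add[OF I that], of "x + y"]
        seminorm_triangle[OF q, of "x + m" "y + n"] by (simp add: algebra_simps)
    then have "?N (x + y) - q (y + n) \<le> ?N x" if "n \<in> I" for n
      using that by (intro quotient_seminorm_greatest[OF I]) (simp add: diff_le_eq)
    then have "?N (x + y) - ?N x \<le> ?N y"
      by (intro quotient_seminorm_greatest[OF I]) (simp add: algebra_simps)
    then show ?thesis by simp
  qed
  moreover have "?N (sc c x) = norm c * ?N x" for c x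
  proof -
    have le: "?N (sc c x) \<le> norm c * ?N x" for c x
    proof -
      have "?N (sc c x) \<le> q (x + m) * norm c" if "m \<in> I" for m
        using quotient_seminorm_le[OF q subspace_scale[OF I that], of "sc c x" c]
        by (simp add: scale_right_distrib[symmetric] seminorm_scale[OF q] mult.commute)
      then have "?N (sc c x) \<le> ?N x * norm c"
        by (intro quotient_seminorm_mult_greatest[OF I]) auto
      then show ?thesis by (simp add: mult.commute)
    qed
    show ?thesis
    proof (cases "c = 0")
      case True
      then show ?thesis using le[of 0 x] nonneg[of 0] by simp
    next
      case False
      then have "norm c * ?N x \<le> norm c * (norm (inverse c) * ?N (sc c x))"
        using le[of "inverse c" "sc c x"] by (intro mult_left_mono) auto
      also have "\<dots> = ?N (sc c x)" using False by (simp add: norm_inverse)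
      finally show ?thesis using le[of c x] by simp
    qed
  qed
  ultimately show ?thesis using nonneg by (simp add: seminorm_def)
qed

end

section \<open>Gelfand--Mazur and maximal ideals in commutative unital algebras\<close>

text \<open>Intended for the closure of the image of \<phi> with \<open>e = \<phi> 1\<close>; the
  ambient algebra may be neither commutative nor unital. By commutativity the left unit is two-sided
  on \<open>C\<close>.\<close>

locale commutative_unital_subalgebra = complex_algebra sc
  for sc :: "complex \<Rightarrow> 'a::ring \<Rightarrow> 'a" +
  fixes C :: "'a set" and e :: 'a
  assumes subspace: "subspace C"
    and mult_closed: "x \<in> C \<Longrightarrow> y \<in> C \<Longrightarrow> x * y \<in> C"
    and commute: "x \<in> C \<Longrightarrow> y \<in> C \<Longrightarrow> x * y = y * x"
    and unit_closed: "e \<in> C"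
    and unit_left: "x \<in> C \<Longrightarrow> e * x = x"
begin

lemmas closed_intros = subspace_0[OF subspace] subspace_add[OF subspace] subspace_diff[OF subspace]
  subspace_scale[OF subspace] mult_closed unit_closed

text \<open>
  Gelfand--Mazur without completeness: if every \<open>x - l e\<close> were invertible modulo \<open>N\<close>, the resolvent
  would satisfy the estimate of the mean value property and vanish at infinity.
\<close>

lemma exists_spectral_value:
  assumes N: "seminorm sc N"
    and submult: "\<And>x y. x \<in> C \<Longrightarrow> y \<in> C \<Longrightarrow> N (x * y) \<le> N x * N y"
    and Ne: "0 < N e" and x: "x \<in> C"
  shows "\<exists>l. \<forall>y\<in>C. N ((x - sc l e) * y - e) \<noteq> 0"
proof (rule ccontr)
  assume "\<not> ?thesis"
  then obtain R where R: "\<And>l. R l \<in> C" and inv: "\<And>l. N ((x - sc l e) * R l - e) = 0"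
    by metis
  \<comment> \<open>The defect of \<open>R l\<close> as an inverse; it is \<open>N\<close>-null, so
    the resolvent identity holds up to null terms.\<close>
  define u where "u l = (x - sc l e) * R l - e" for l
  have uC: "u l \<in> C" and Nu: "N (u l) = 0" for l
    using R x inv by (auto simp: u_def intro!: closed_intros)
  have u_eq: "u l = x * R l - sc l (R l) - e" for l
    by (simp add: u_def left_diff_distrib scale_mult_left unit_left R)
  have resolvent: "R m - R l - sc (m - l) (R m * R l) = R l * u m - R m * u l" for l m
  proof -
    have 1: "R l * (x * R m) = R m * (x * R l)"
      using R x by (metis commute mult.assoc mult_closed)
    have 2: "R l * R m = R m * R l" "R l * e = R l" "R m * e = R m"
      using R commute unit_closed unit_left by metis+
    show ?thesis
      unfolding u_eq by (simp add: right_diff_distrib mult_scale_right 1 2 scale_left_diff_distrib)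
  qed
  have null_mult: "N (y * u l) = 0" if "y \<in> C" for y l
    using submult[OF that uC[of l]] seminorm_nonneg[OF N, of "y * u l"] by (simp add: Nu)
  have resolvent0: "N (R m - R l - sc (m - l) (R m * R l)) = 0" for l m
    unfolding resolvent
    using seminorm_diff[OF N, of "R l * u m" "R m * u l"] seminorm_nonneg[OF N, of "R l * u m - R m * u l"]
    by (simp add: null_mult R)
  have diff_le: "N (R m - R l) \<le> norm (m - l) * (N (R m) * N (R l))" for l m
  proof -
    have "N (R m - R l) \<le> N (R m - R l - sc (m - l) (R m * R l)) + N (sc (m - l) (R m * R l))"
      using seminorm_triangle[OF N, of "R m - R l - sc (m - l) (R m * R l)" "sc (m - l) (R m * R l)"] by simp
    also have "\<dots> \<le> norm (m - l) * (N (R m) * N (R l))"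
      unfolding resolvent0 seminorm_scale[OF N] using submult[OF R R] by (simp add: mult_left_mono)
    finally show ?thesis .
  qed
  have pos: "0 < N (R l)" for l
  proof (rule ccontr)
    assume "\<not> ?thesis"
    then have "N (R l) = 0" using seminorm_nonneg[OF N, of "R l"] by simp
    then have "N ((x - sc l e) * R l) \<le> 0"
      using submult[of "x - sc l e" "R l"] x R by (simp add: closed_intros)
    moreover have "N e \<le> N ((x - sc l e) * R l) + N (u l)"
      using seminorm_diff[OF N, of "(x - sc l e) * R l" "u l"] by (simp add: u_def)
    ultimately show False using Ne Nu[of l] by simp
  qed
  \<comment> \<open>Dividing the resolvent estimate by \<open>N (R m) * N (R l)\<close> gives a
    Lipschitz bound for the reciprocal, without any prior bound on \<open>R\<close>. Compactness
    then bounds \<open>N (R l)\<close> on discs.\<close>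
  have lip: "\<bar>1 / N (R m) - 1 / N (R l)\<bar> \<le> norm (m - l)" for l m
  proof -
    have "N (R m) \<le> N (R l) + N (R m - R l)" for l m
      using seminorm_triangle[OF N, of "R l" "R m - R l"] by simp
    then have "\<bar>N (R l) - N (R m)\<bar> \<le> norm (m - l) * (N (R m) * N (R l))"
      using diff_le[of l m] diff_le[of m l]
      by (smt (verit) norm_minus_commute mult.commute)
    moreover have "\<bar>1 / N (R m) - 1 / N (R l)\<bar> = \<bar>N (R l) - N (R m)\<bar> / (N (R m) * N (R l))"
      using pos[of l] pos[of m] by (simp add: field_simps abs_divide abs_mult)
    ultimately show ?thesis
      using pos[of l] pos[of m] by (simp add: divide_le_eq)
  qed
  have cont: "continuous_on A (\<lambda>l. 1 / N (R l))" for A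
    by (rule lipschitz_on_continuous_on[of 1], rule lipschitz_onI)
      (use lip in \<open>auto simp: dist_norm\<close>)
  \<comment> \<open>Half the value at the centre, so that \<open>N (R 0) \<le> b\<close> is
    absurd.\<close>
  define b where "b = N (R 0) / 2"
  have b: "0 < b" using pos by (simp add: b_def)
  \<comment> \<open>Large enough for the circle: \<open>l R l = x R l - e\<close> modulo null terms
    yields \<open>(\<rho> - N x) * N (R l) \<le> N e\<close>, hence
    \<open>N (R l) \<le> b\<close>.\<close>
  define \<rho> where "\<rho> = N x + N e / b + 1"
  have \<rho>: "0 < \<rho>" using b Ne seminorm_nonneg[OF N, of x] by (simp add: \<rho>_def add_nonneg_pos)
  obtain c where c: "0 < c" "\<And>l. norm l \<le> \<rho> \<Longrightarrow> c \<le> 1 / N (R l)"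
  proof -
    obtain k where "\<forall>l\<in>cball 0 \<rho>. 1 / N (R k) \<le> 1 / N (R l)"
      using continuous_attains_inf[OF compact_cball _ cont, of 0 \<rho>] \<rho> by (auto simp del: mem_cball)
    then show thesis using pos[of k] by (intro that[of "1 / N (R k)"]) auto
  qed
  define M where "M = 1 / c"
  have M: "N (R l) \<le> M" if "norm l \<le> \<rho>" for l
    using c(1) c(2)[OF that] pos[of l] by (simp add: M_def field_simps)
  have "0 < M" using c by (simp add: M_def)
  have "N (R 0) \<le> b"
  \<comment> \<open>The formal derivative of the resolvent is its square. By the resolvent identity
    the Taylor remainder is \<open>(m - l) (R m - R l) R l\<close> up to null terms, and a second
    use bounds it by \<open>M ^ 3\<close> times the squared distance.\<close>
  proof (rule seminorm_center_le_circle[OF N \<rho>, where D = "\<lambda>l. R l * R l" and K = "M ^ 3"])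
    fix l m :: complex assume lm: "norm l \<le> \<rho>" "norm m \<le> \<rho>"
    have "N ((R m - R l) * R l) \<le> N (R m - R l) * N (R l)"
      using R by (intro submult closed_intros)
    also have "\<dots> \<le> norm (m - l) * (M * M) * M"
      using diff_le[of m l] M[OF lm(1)] M[OF lm(2)] pos[of l] pos[of m] \<open>0 < M\<close>
      by (intro mult_mono order_trans[OF diff_le] mult_nonneg_nonneg seminorm_nonneg[OF N]) auto
    finally have 1: "N ((R m - R l) * R l) \<le> norm (m - l) * M ^ 3"
      by (simp add: power3_eq_cube mult.assoc)
    have "R m - R l - sc (m - l) (R l * R l) =
        (R m - R l - sc (m - l) (R m * R l)) + sc (m - l) ((R m - R l) * R l)"
      by (simp add: left_diff_distrib scale_right_diff_distrib)
    then have "N (R m - R l - sc (m - l) (R l * R l)) \<le>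
        N (R m - R l - sc (m - l) (R m * R l)) + N (sc (m - l) ((R m - R l) * R l))"
      using seminorm_triangle[OF N] by metis
    also have "\<dots> \<le> norm (m - l) * (norm (m - l) * M ^ 3)"
      unfolding resolvent0 seminorm_scale[OF N] using 1 by (simp add: mult_left_mono)
    finally show "N (R m - R l - sc (m - l) (R l * R l)) \<le> M ^ 3 * (norm (m - l))\<^sup>2"
      by (simp add: power2_eq_square algebra_simps)
  next
    fix l :: complex assume l: "norm l = \<rho>"
    have "sc l (R l) = (x * R l - e) - u l" by (simp add: u_eq)
    then have "N (sc l (R l)) \<le> N (x * R l - e) + N (u l)" using seminorm_diff[OF N] by metis
    also have "N (x * R l - e) \<le> N (x * R l) + N e" by (rule seminorm_diff[OF N])
    also have "N (x * R l) \<le> N x * N (R l)" using x R by (rule submult)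
    finally have "(N e / b + 1) * N (R l) \<le> N e"
      by (simp add: seminorm_scale[OF N] l Nu \<rho>_def algebra_simps)
    then have "(N e + b) * N (R l) \<le> N e * b"
      using b by (simp add: field_simps)
    also have "\<dots> \<le> (N e + b) * b" using b by (simp add: algebra_simps)
    finally show "N (R l) \<le> b" using b Ne by simp
  qed
  then show False using b by (simp add: b_def)
qed

text \<open>The product \<open>(x + m) * (y + n)\<close> lies in the coset of \<open>x * y\<close>:
  commutativity turns \<open>m * y\<close> into \<open>y * m\<close>, which the left ideal absorbs.
  The infima over \<open>m\<close> and \<open>n\<close> are taken in turn.\<close>

lemma quotient_seminorm_submult:
  assumes q: "seminorm sc q"
    and submult: "\<And>x y. x \<in> C \<Longrightarrow> y \<in> C \<Longrightarrow> q (x * y) \<le> q x * q y"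
    and I: "left_ideal sc C I" and x: "x \<in> C" and y: "y \<in> C"
  shows "quotient_seminorm I q (x * y) \<le> quotient_seminorm I q x * quotient_seminorm I q y"
proof -
  let ?N = "quotient_seminorm I q"
  have sub: "subspace I" and IC: "I \<subseteq> C" and mult: "\<And>c x. c \<in> C \<Longrightarrow> x \<in> I \<Longrightarrow> c * x \<in> I"
    using I by (auto simp: left_ideal_def)
  have *: "?N (x * y) \<le> q (x + m) * q (y + n)" if m: "m \<in> I" and n: "n \<in> I" for m n
  proof -
    have C: "m \<in> C" "n \<in> C" using m n IC by auto
    have "x * n + y * m + m * n \<in> I"
      using m n x y C mult by (intro subspace_add[OF sub]) auto
    from quotient_seminorm_le[OF q this, of "x * y"]
    have "?N (x * y) \<le> q (x * y + (x * n + y * m + m * n))" .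
    also have "x * y + (x * n + y * m + m * n) = (x + m) * (y + n)"
      using commute[OF y C(1)] by (simp add: algebra_simps)
    also have "q \<dots> \<le> q (x + m) * q (y + n)"
      using x y C by (intro submult closed_intros)
    finally show ?thesis .
  qed
  have **: "?N (x * y) \<le> ?N x * q (y + n)" if "n \<in> I" for n
    by (rule quotient_seminorm_mult_greatest[OF sub seminorm_nonneg[OF q]]) (rule *[OF _ that])
  have "?N (x * y) \<le> ?N y * ?N x"
    by (rule quotient_seminorm_mult_greatest[OF sub seminorm_nonneg[OF seminorm_quotient_seminorm[OF q sub]]])
      (use ** in \<open>simp add: mult.commute\<close>)
  then show ?thesis by (simp add: mult.commute)
qed

text \<open>By commutativity \<open>c = c * e\<close>, so a left ideal containing \<open>e\<close>
  is all of \<open>C\<close>.\<close>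

lemma unit_notin_maximal_left_ideal:
  assumes "maximal_left_ideal sc C I"
  shows "e \<notin> I"
proof
  assume "e \<in> I"
  then have "c * e \<in> I" if "c \<in> C" for c
    using assms that by (auto simp: maximal_left_ideal_def left_ideal_def)
  then have "C \<subseteq> I" using commute unit_closed unit_left by (metis subsetI)
  then show False using assms by (auto simp: maximal_left_ideal_def left_ideal_def)
qed

text \<open>The left ideal \<open>I + C x\<close> properly contains \<open>I\<close>, so by
  maximality it contains \<open>e\<close>.\<close>

lemma inverse_modulo_maximal_left_ideal:
  assumes max: "maximal_left_ideal sc C I" and x: "x \<in> C" "x \<notin> I"
  shows "\<exists>r\<in>C. r * x - e \<in> I"
proof -
  have sub: "subspace I" and IC: "I \<subseteq> C" and mult: "\<And>c x. c \<in> C \<Longrightarrow> x \<in> I \<Longrightarrow> c * x \<in> I"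
    using max by (auto simp: left_ideal_def maximal_left_ideal_def)
  define J where "J = {m + c * x |m c. m \<in> I \<and> c \<in> C}"
  have JI: "m + c * x \<in> J" if "m \<in> I" "c \<in> C" for m c
    using that by (auto simp: J_def)
  have "left_ideal sc C J"
    unfolding left_ideal_def
  proof (intro conjI ballI)
    show "J \<subseteq> C" using IC x by (auto simp: J_def intro!: closed_intros)
    show "subspace J"
    proof (rule subspaceI)
      show "0 \<in> J" using JI[OF subspace_0[OF sub] closed_intros(1)] by simp
    next
      fix y z assume "y \<in> J" "z \<in> J"
      then obtain m c n d where "m \<in> I" "c \<in> C" "n \<in> I" "d \<in> C" "y = m + c * x" "z = n + d * x"
        by (auto simp: J_def)
      then show "y + z \<in> J"
        using JI[OF subspace_add[OF sub, of m n] closed_intros(2), of c d] by (simp add: algebra_simps)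
    next
      fix k y assume "y \<in> J"
      then obtain m c where "m \<in> I" "c \<in> C" "y = m + c * x" by (auto simp: J_def)
      then show "sc k y \<in> J"
        using JI[OF subspace_scale[OF sub, of m k] closed_intros(4), of c k]
        by (simp add: scale_right_distrib scale_mult_left)
    qed
  next
    fix k y assume k: "k \<in> C" and "y \<in> J"
    then obtain m c where "m \<in> I" "c \<in> C" "y = m + c * x" by (auto simp: J_def)
    then show "k * y \<in> J"
      using JI[OF mult[OF k, of m] mult_closed[OF k, of c]] by (simp add: distrib_left mult.assoc)
  qed
  moreover have "I \<subseteq> J"
  proof
    fix m assume "m \<in> I"
    then show "m \<in> J" using JI[OF _ closed_intros(1), of m] by simp
  qed
  moreover have "x \<in> J" using JI[OF subspace_0[OF sub] unit_closed] x by (simp add: unit_left)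
  ultimately have "J = C" using max x by (auto simp: maximal_left_ideal_def)
  then have "e \<in> J" using unit_closed by simp
  then obtain m c where mc: "m \<in> I" "c \<in> C" "e = m + c * x" by (auto simp: J_def)
  then have "c * x - e = - m" by simp
  then show ?thesis using mc subspace_neg[OF sub] by metis
qed

text \<open>
  For \<open>\<epsilon> * norm l > q x\<close> the element \<open>- x / l\<close> would be quasi-invertible, making \<open>x - l e\<close> a unit.
\<close>

lemma quasi_invertible_ball_bound:
  assumes q: "seminorm sc q"
    and ball: "\<And>y. y \<in> C \<Longrightarrow> q y < \<epsilon> \<Longrightarrow> y \<in> quasi_invertibles C"
    and max: "maximal_left_ideal sc C I" and x: "x \<in> C" "x - sc l e \<in> I"
  shows "\<epsilon> * norm l \<le> q x"
proof (rule ccontr)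
  assume neg: "\<not> \<epsilon> * norm l \<le> q x"
  have sub: "subspace I" and mult: "\<And>c x. c \<in> C \<Longrightarrow> x \<in> I \<Longrightarrow> c * x \<in> I"
    using max by (auto simp: left_ideal_def maximal_left_ideal_def)
  have l: "l \<noteq> 0" using neg seminorm_nonneg[OF q, of x] by auto
  define y where "y = sc (- inverse l) x"
  have yC: "y \<in> C" unfolding y_def using x by (intro closed_intros)
  have "q y = q x / norm l" unfolding y_def seminorm_scale[OF q] by (simp add: norm_inverse divide_inverse)
  also have "\<dots> < \<epsilon>" using neg l by (simp add: divide_less_eq)
  finally obtain z where z: "z \<in> C" "y + z + z * y = 0"
    using ball[OF yC] by (auto simp: quasi_invertibles_def)
  have "sc (- inverse l) (x - sc l e) \<in> I"
    by (rule subspace_scale[OF sub x(2)])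
  also have "sc (- inverse l) (x - sc l e) = y + e"
    using l by (simp add: y_def scale_right_diff_distrib)
  \<comment> \<open>This product expands to \<open>e + (y + z + z * y) = e\<close>, which cannot lie
    in \<open>I\<close>.\<close>
  finally have "(e + z) * (y + e) \<in> I"
    using z unit_closed by (intro mult closed_intros)
  also have "(e + z) * (y + e) = e + (y + z + z * y)"
    using commute[OF z(1) unit_closed]
    by (simp add: distrib_left distrib_right unit_left yC z(1) unit_closed)
  finally show False using z(2) unit_notin_maximal_left_ideal[OF max] by simp
qed

text \<open>A spectral value \<open>l\<close> of \<open>x\<close> for the quotient seminorm works:
  if \<open>x - l e\<close> were outside \<open>I\<close>, it would have an inverse modulo
  \<open>I\<close>, where that seminorm vanishes.\<close>

lemma exists_scalar_modulo_maximal_left_ideal: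
  assumes q: "seminorm sc q"
    and submult: "\<And>x y. x \<in> C \<Longrightarrow> y \<in> C \<Longrightarrow> q (x * y) \<le> q x * q y"
    and \<epsilon>: "0 < \<epsilon>" and ball: "\<And>y. y \<in> C \<Longrightarrow> q y < \<epsilon> \<Longrightarrow> y \<in> quasi_invertibles C"
    and max: "maximal_left_ideal sc C I" and x: "x \<in> C"
  shows "\<exists>l. x - sc l e \<in> I"
proof -
  let ?N = "quotient_seminorm I q"
  have I: "left_ideal sc C I" using max by (simp add: maximal_left_ideal_def)
  then have sub: "subspace I" and IC: "I \<subseteq> C" by (auto simp: left_ideal_def)
  \<comment> \<open>\<open>e + m\<close> is congruent to \<open>1 e\<close> modulo \<open>I\<close>,
    so the ball bound keeps the unit away from 0 in the quotient seminorm.\<close>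
  have "\<epsilon> \<le> q (e + m)" if "m \<in> I" for m
    using quasi_invertible_ball_bound[OF q ball max, where x = "e + m" and l = 1] that IC
    by (auto intro: closed_intros)
  then have "\<epsilon> \<le> ?N e" by (rule quotient_seminorm_greatest[OF sub])
  with \<epsilon> have "0 < ?N e" by simp
  then obtain l where l: "\<And>y. y \<in> C \<Longrightarrow> ?N ((x - sc l e) * y - e) \<noteq> 0"
    using exists_spectral_value[OF seminorm_quotient_seminorm[OF q sub]
        quotient_seminorm_submult[OF q submult I] _ x] by blast
  have C: "x - sc l e \<in> C" using x by (intro closed_intros)
  have "x - sc l e \<in> I"
  proof (rule ccontr)
    assume "x - sc l e \<notin> I"
    then obtain r where r: "r \<in> C" "r * (x - sc l e) - e \<in> I"
      using inverse_modulo_maximal_left_ideal[OF max C] by blast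
    then have "?N (r * (x - sc l e) - e) = 0" by (intro quotient_seminorm_eq_0[OF q sub])
    then show False using l[OF r(1)] by (simp only: commute[OF r(1) C] not_True_eq_False)
  qed
  then show ?thesis ..
qed

text \<open>The scalar congruent to \<open>x\<close> modulo \<open>I\<close> is unique because
  \<open>e \<notin> I\<close>, and uniqueness makes it linear and multiplicative in
  \<open>x\<close>. The laws are confined to \<open>C\<close>, as the values of \<open>g\<close>
  outside \<open>C\<close> are arbitrary.\<close>

lemma exists_character_of_maximal_left_ideal:
  assumes q: "seminorm sc q"
    and submult: "\<And>x y. x \<in> C \<Longrightarrow> y \<in> C \<Longrightarrow> q (x * y) \<le> q x * q y"
    and \<epsilon>: "0 < \<epsilon>" and ball: "\<And>y. y \<in> C \<Longrightarrow> q y < \<epsilon> \<Longrightarrow> y \<in> quasi_invertibles C"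
    and max: "maximal_left_ideal sc C I"
  obtains g where "g e = 1"
    and "\<And>x y. x \<in> C \<Longrightarrow> y \<in> C \<Longrightarrow> g (x + y) = g x + g y"
    and "\<And>c x. x \<in> C \<Longrightarrow> g (sc c x) = c * g x"
    and "\<And>x y. x \<in> C \<Longrightarrow> y \<in> C \<Longrightarrow> g (x * y) = g x * g y"
    and "\<And>x. x \<in> C \<Longrightarrow> \<epsilon> * norm (g x) \<le> q x"
    and "\<And>x. x \<in> C \<Longrightarrow> g x = 0 \<Longrightarrow> x \<in> I"
proof -
  obtain g where g: "\<And>x. x \<in> C \<Longrightarrow> x - sc (g x) e \<in> I"
    using exists_scalar_modulo_maximal_left_ideal[OF q submult \<epsilon> ball max] by metis
  have sub: "subspace I" and IC: "I \<subseteq> C" and mult: "\<And>c x. c \<in> C \<Longrightarrow> x \<in> I \<Longrightarrow> c * x \<in> I"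
    using max by (auto simp: left_ideal_def maximal_left_ideal_def)
  have unique: "g x = l" if "x \<in> C" "x - sc l e \<in> I" for x l
  proof (rule ccontr)
    assume "g x \<noteq> l"
    have "(x - sc l e) - (x - sc (g x) e) \<in> I" by (rule subspace_diff[OF sub that(2) g[OF that(1)]])
    also have "(x - sc l e) - (x - sc (g x) e) = sc (g x - l) e" by (simp add: scale_left_diff_distrib)
    finally have "sc (inverse (g x - l)) (sc (g x - l) e) \<in> I" by (rule subspace_scale[OF sub])
    then show False using \<open>g x \<noteq> l\<close> unit_notin_maximal_left_ideal[OF max] by simp
  qed
  show thesis
  proof
    show "g e = 1" by (rule unique) (simp_all add: unit_closed subspace_0[OF sub])
  next
    fix x y assume xy: "x \<in> C" "y \<in> C"
    have "x + y - sc (g x + g y) e = (x - sc (g x) e) + (y - sc (g y) e)"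
      by (simp add: scale_left_distrib)
    also have "\<dots> \<in> I" using g xy by (intro subspace_add[OF sub])
    finally show "g (x + y) = g x + g y" using xy by (intro unique closed_intros)
    have "x * y - sc (g x * g y) e = y * (x - sc (g x) e) + sc (g x) (y - sc (g y) e)"
      using commute[OF xy] commute[OF xy(2) unit_closed]
      by (simp add: right_diff_distrib mult_scale_right scale_right_diff_distrib unit_left xy)
    also have "\<dots> \<in> I" using g xy by (intro subspace_add[OF sub] subspace_scale[OF sub] mult)
    finally show "g (x * y) = g x * g y" using xy by (intro unique closed_intros)
  next
    fix c x assume x: "x \<in> C"
    have "sc c x - sc (c * g x) e = sc c (x - sc (g x) e)"
      by (simp add: scale_right_diff_distrib)
    also have "\<dots> \<in> I" using g x by (intro subspace_scale[OF sub])
    finally show "g (sc c x) = c * g x" using x by (intro unique closed_intros)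
  next
    fix x assume x: "x \<in> C"
    show "\<epsilon> * norm (g x) \<le> q x" by (rule quasi_invertible_ball_bound[OF q ball max x g[OF x]])
    show "x \<in> I" if "g x = 0" using g[OF x] that by simp
  qed
qed

end

section \<open>Closures of subalgebras and balls of seminorms\<close>

context topological_algebra
begin

lemma continuous_on_add_left: "continuous_on A (\<lambda>x::'a. a + x)"
  using continuous_on_compose2[OF continuous_add continuous_on_Pair[OF continuous_on_const continuous_on_id]]
  by (simp add: continuous_on_subset)

lemma continuous_on_scale_right: "continuous_on A (sc c)"
  using continuous_on_compose2[OF continuous_scale continuous_on_Pair[OF continuous_on_const continuous_on_id]]
  by (simp add: continuous_on_subset)

text \<open>
  Multiplication is only separately continuous, so an identity or a closure property in two variables is
  passed to the closure one variable at a time.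
\<close>

lemma closure_induct2:
  assumes D: "\<And>x y. x \<in> D \<Longrightarrow> y \<in> D \<Longrightarrow> P x y"
    and closed: "\<And>x. closed {y. P x y}" "\<And>y. closed {x. P x y}"
    and "x \<in> closure D" "y \<in> closure D"
  shows "P x y"
proof -
  \<comment> \<open>First \<open>y\<close> runs through the closure with \<open>x\<close> still in
    \<open>D\<close>; then \<open>x\<close> follows for each such \<open>y\<close>.\<close>
  have "closure D \<subseteq> {y. P x y}" if "x \<in> D" for x
    using D that closed by (intro closure_minimal) auto
  then have "closure D \<subseteq> {x. P x y}" if "y \<in> closure D" for y
    using that closed by (intro closure_minimal) auto
  then show ?thesis using assms by auto
qed

text \<open>Each algebra law is a closed condition in every variable separately. It serves to make
  the closure of the image of \<phi> commutative and unital.\<close>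

lemma commutative_unital_subalgebra_closure:
  assumes D: "commutative_unital_subalgebra sc D e"
  shows "commutative_unital_subalgebra sc (closure D) e"
proof -
  interpret D: commutative_unital_subalgebra sc D e by (rule D)
  have sub: "D \<subseteq> closure D" by (rule closure_subset)
  have cont: "closed {y. f y \<in> closure D}" if "continuous_on UNIV f" for f :: "'a \<Rightarrow> 'a"
    using continuous_closed_vimage[of "closure D" f] that
    by (simp add: vimage_def continuous_on_eq_continuous_at)
  have cont_add: "continuous_on UNIV (\<lambda>x::'a. x + a)" for a
    using continuous_on_add_left[of UNIV a] by (simp add: add.commute)
  show ?thesis
  proof
    have "0 \<in> closure D" using D.closed_intros(1) sub by auto
    moreover have "x + y \<in> closure D" if "x \<in> closure D" "y \<in> closure D" for x y
      by (rule closure_induct2[OF _ _ _ that])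
        (use D.closed_intros(2) sub cont cont_add continuous_on_add_left in auto)
    moreover have "sc c x \<in> closure D" if "x \<in> closure D" for c x
      using image_closure_subset[OF continuous_on_scale_right closed_closure, of c D D]
        D.closed_intros(4)[of _ c] sub that by blast
    ultimately show "subspace (closure D)" by (intro subspaceI)
  next
    fix x y assume xy: "x \<in> closure D" "y \<in> closure D"
    show "x * y \<in> closure D"
      by (rule closure_induct2[OF _ _ _ xy])
        (use D.mult_closed sub cont continuous_mult_left continuous_mult_right in auto)
    show "x * y = y * x"
      by (rule closure_induct2[OF _ _ _ xy])
        (use D.commute in \<open>auto intro!: closed_Collect_eq continuous_mult_left continuous_mult_right\<close>)
  next
    show "e \<in> closure D" using D.unit_closed sub by auto
  next
    fix x assume "x \<in> closure D"
    moreover have "closed {x. e * x = x}"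
      by (intro closed_Collect_eq continuous_mult_left continuous_on_id)
    then have "closure D \<subseteq> {x. e * x = x}" using D.unit_left by (intro closure_minimal) auto
    ultimately show "e * x = x" by auto
  qed
qed

text \<open>Lets one seminorm, the sum, stand for finitely many members of a family that need not be
  directed.\<close>

lemma open_sum_seminorms_ball:
  assumes top: "topology_determined_by S p" and sn: "\<And>s. s \<in> S \<Longrightarrow> seminorm sc (p s)"
    and F: "finite F" "F \<subseteq> S"
  shows "open {y. (\<Sum>s\<in>F. p s (y - x)) < \<delta>}"
  unfolding top[unfolded topology_determined_by_def, rule_format]
proof
  fix z assume z: "z \<in> {y. (\<Sum>s\<in>F. p s (y - x)) < \<delta>}"
  \<comment> \<open>The slack at \<open>z\<close>, shared among the members of \<open>F\<close>; the
    extra 1 covers empty \<open>F\<close> and keeps the final inequality strict.\<close>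
  define \<eta> where "\<eta> = (\<delta> - (\<Sum>s\<in>F. p s (z - x))) / (1 + real (card F))"
  have \<eta>: "0 < \<eta>" using z by (simp add: \<eta>_def)
  have \<eta>_eq: "real (card F) * \<eta> + \<eta> = \<delta> - (\<Sum>s\<in>F. p s (z - x))"
  proof -
    have "real (card F) * \<eta> + \<eta> = (1 + real (card F)) * \<eta>" by (simp add: algebra_simps)
    then show ?thesis unfolding \<eta>_def by simp
  qed
  have "(\<Sum>s\<in>F. p s (y - x)) < \<delta>" if y: "\<forall>s\<in>F. p s (y - z) < \<eta>" for y
  proof -
    have "(\<Sum>s\<in>F. p s (y - x)) \<le> (\<Sum>s\<in>F. p s (y - z) + p s (z - x))"
    proof (rule sum_mono)
      fix s assume "s \<in> F"
      then show "p s (y - x) \<le> p s (y - z) + p s (z - x)"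
        using seminorm_triangle[OF sn, of s "y - z" "z - x"] F by auto
    qed
    also have "\<dots> = (\<Sum>s\<in>F. p s (y - z)) + (\<Sum>s\<in>F. p s (z - x))" by (rule sum.distrib)
    also have "(\<Sum>s\<in>F. p s (y - z)) \<le> real (card F) * \<eta>"
      using y by (intro sum_bounded_above) (auto intro: less_imp_le)
    finally show ?thesis using \<eta> \<eta>_eq by linarith
  qed
  then show "\<exists>G e. finite G \<and> G \<subseteq> S \<and> 0 < e \<and>
      {y. \<forall>s\<in>G. p s (y - z) < e} \<subseteq> {y. (\<Sum>s\<in>F. p s (y - x)) < \<delta>}"
    using F \<eta> by (intro exI[of _ F] exI[of _ \<eta>]) auto
qed

end

text \<open>Since 0 is quasi-invertible, finitely many submultiplicative seminorms cut out a
  suitable ball around it. Their sum \<open>q\<close> dominates each of them, and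
  \<open>r x * r y \<le> r x * q y\<close> shows that it is again submultiplicative.\<close>

lemma (in locally_m_convex_algebra) Q_algebra_quasi_invertible_ball:
  assumes Q: "Q_algebra C" and C: "0 \<in> C"
  obtains q \<epsilon> where "seminorm sc q" "submultiplicative q" "\<And>x \<delta>. open {y. q (y - x) < \<delta>}"
    "0 < \<epsilon>" "\<And>y. y \<in> C \<Longrightarrow> q y < \<epsilon> \<Longrightarrow> y \<in> quasi_invertibles C"
proof -
  obtain P where P: "\<And>r. r \<in> P \<Longrightarrow> seminorm sc r" "\<And>r. r \<in> P \<Longrightarrow> submultiplicative r"
    and top: "topology_determined_by P (\<lambda>r. r)"
    using determined_submultiplicative by blast
  obtain U where U: "open U" "quasi_invertibles C = C \<inter> U"
    using Q by (auto simp: Q_algebra_def openin_open)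
  have "0 \<in> quasi_invertibles C" using C by (auto simp: quasi_invertibles_def)
  then have "0 \<in> U" using U by simp
  then obtain F \<epsilon> where F: "finite F" "F \<subseteq> P" "0 < \<epsilon>" "{y. \<forall>r\<in>F. r (y - 0) < \<epsilon>} \<subseteq> U"
    using top[unfolded topology_determined_by_def, rule_format, of U] U(1) by blast
  define q where "q y = (\<Sum>r\<in>F. r y)" for y
  have nonneg: "0 \<le> r y" if "r \<in> F" for r y
    using seminorm_nonneg[OF P(1)] F(2) that by auto
  show thesis
  proof
    show "seminorm sc q"
      unfolding seminorm_def
    proof (intro conjI allI)
      show "0 \<le> q x" for x unfolding q_def by (intro sum_nonneg nonneg)
      show "q (x + y) \<le> q x + q y" for x y
        unfolding q_def sum.distrib[symmetric]
        using F(2) by (intro sum_mono seminorm_triangle P(1)) auto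
      show "q (sc c x) = norm c * q x" for c x
        unfolding q_def sum_distrib_left
        using F(2) by (intro sum.cong refl seminorm_scale P(1)) auto
    qed
    show "submultiplicative q"
      unfolding submultiplicative_def
    proof (intro allI)
      fix x y
      have "q (x * y) \<le> (\<Sum>r\<in>F. r x * r y)"
        unfolding q_def using F(2) P(2) by (intro sum_mono) (auto simp: submultiplicative_def)
      also have "\<dots> \<le> (\<Sum>r\<in>F. r x * q y)"
        using F(1) nonneg unfolding q_def by (intro sum_mono mult_left_mono member_le_sum) auto
      also have "\<dots> = q x * q y" by (simp add: q_def sum_distrib_right)
      finally show "q (x * y) \<le> q x * q y" .
    qed
    show "open {y. q (y - x) < \<delta>}" for x \<delta>
      unfolding q_def using open_sum_seminorms_ball[OF top P(1) F(1,2)] by simp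
    show "0 < \<epsilon>" by (rule F(3))
    fix y assume y: "y \<in> C" "q y < \<epsilon>"
    have "r y < \<epsilon>" if "r \<in> F" for r
      using member_le_sum[of r F "\<lambda>r. r y"] that nonneg F(1) y(2) by (auto simp: q_def)
    then show "y \<in> quasi_invertibles C" using F(4) U(2) y(1) by auto
  qed
qed

section \<open>Characters and property (P)\<close>

lemma algebra_hom_iff:
  "algebra_hom sA sB h \<longleftrightarrow> vector_space sA \<and> vector_space sB \<and> (\<forall>x y. h (x + y) = h x + h y) \<and>
     (\<forall>c x. h (sA c x) = sB c (h x)) \<and> (\<forall>x y. h (x * y) = h x * h y)"
  by (auto simp: algebra_hom_def Vector_Spaces.linear_iff)

text \<open>Rescaling \<open>x\<close> to \<open>p s x = 1\<close> reduces this to (P). If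
  \<open>p s x = 0\<close>, any character does, and (P) provides one.\<close>

lemma (in complex_algebra) property_P_dominates:
  assumes P: "property_P sc S p" and s: "s \<in> S" and sn: "seminorm sc (p s)"
  shows "\<exists>f\<in>characters sc. p s x \<le> norm (f x)"
proof (cases "p s x = 0")
  case True
  then show ?thesis using P by (auto simp: property_P_def)
next
  case False
  then have pos: "0 < p s x" using seminorm_nonneg[OF sn, of x] by simp
  define c where "c = complex_of_real (1 / p s x)"
  have "p s (sc c x) = 1" using pos by (simp add: seminorm_scale[OF sn] c_def norm_divide)
  then obtain f where f: "f \<in> characters sc" "1 \<le> norm (f (sc c x))"
    using P s by (auto simp: property_P_def)
  moreover have "norm (f (sc c x)) = norm (f x) / p s x"
    using f(1) pos by (simp add: characters_def algebra_hom_iff c_def norm_mult norm_divide)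
  ultimately show ?thesis using pos by (auto simp: le_divide_eq)
qed

context locally_convex_algebra
begin

text \<open>The topology is Hausdorff, so a nonzero \<open>x\<close> has a seminorm neighbourhood
  avoiding 0; but 0 lies in every such ball if all seminorms vanish at \<open>x\<close>.\<close>

lemma eq_0_if_seminorms_0:
  assumes "\<And>s. s \<in> S \<Longrightarrow> p s x = 0"
  shows "x = 0"
proof (rule ccontr)
  assume "x \<noteq> 0"
  moreover have "open (- {0::'a})" by (intro open_Compl closed_singleton)
  ultimately obtain F e where F: "F \<subseteq> S" "0 < e" "{y. \<forall>s\<in>F. p s (y - x) < e} \<subseteq> - {0}"
    using determined[unfolded topology_determined_by_def, rule_format, of "- {0}"] by blast
  have "p s (0 - x) = 0" if "s \<in> F" for s
    using assms seminorm_minus[OF seminorms] F(1) that by auto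
  then show False using F(2,3) by force
qed

lemma property_P_characters_separate:
  assumes P: "property_P sc S p" and x: "\<And>f. f \<in> characters sc \<Longrightarrow> f x = 0"
  shows "x = 0"
proof (rule eq_0_if_seminorms_0)
  fix s assume s: "s \<in> S"
  obtain f where f: "f \<in> characters sc" "p s x \<le> norm (f x)"
    using property_P_dominates[OF P s seminorms[OF s]] by blast
  then show "p s x = 0" using x[OF f(1)] seminorm_nonneg[OF seminorms[OF s], of x] by simp
qed

text \<open>Characters take values in a commutative field, so they all kill the commutator.\<close>

lemma property_P_commutative:
  assumes "property_P sc S p"
  shows "x * y = y * (x::'a)"
proof -
  have "x * y - y * x = 0"
  proof (rule property_P_characters_separate[OF assms])
    fix f assume f: "f \<in> characters sc"
    then have add: "\<And>x y. f (x + y) = f x + f y" and mult: "\<And>x y. f (x * y) = f x * f y"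
      by (auto simp: characters_def algebra_hom_iff)
    have "f (x * y) = f (x * y - y * x) + f (y * x)" by (simp flip: add)
    then show "f (x * y - y * x) = 0" by (simp add: mult mult.commute)
  qed
  then show ?thesis by simp
qed

end

section \<open>Continuity of the inverse homomorphism\<close>

theorem theorem3p1:
  fixes sA :: "complex \<Rightarrow> 'a::{ring_1,t2_space} \<Rightarrow> 'a"
    and sB :: "complex \<Rightarrow> 'b::{ring,t2_space} \<Rightarrow> 'b"
    and S :: "'s set" and p :: "'s \<Rightarrow> 'a \<Rightarrow> real"
    and \<phi> :: "'a \<Rightarrow> 'b"
  assumes "locally_convex_algebra sA S p"
    and "weakly_regular sA"
    and "property_P sA S p"
    and "locally_m_convex_algebra sB"
    and "algebra_hom sA sB \<phi>"
    and "inj \<phi>"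
    and "semisimple sB (closure (range \<phi>))"
    and "Q_algebra (closure (range \<phi>))"
    and "functionally_continuous sA"
  shows "continuous_on (range \<phi>) (inv \<phi>)"
proof -
  interpret A: locally_convex_algebra sA S p by fact
  interpret B: locally_m_convex_algebra sB by fact
  let ?C = "closure (range \<phi>)"
  have \<phi>: "\<phi> (x + y) = \<phi> x + \<phi> y" "\<phi> (sA c x) = sB c (\<phi> x)" "\<phi> (x * y) = \<phi> x * \<phi> y" for x y c
    using assms(5) by (auto simp: algebra_hom_iff)
  have \<phi>0: "\<phi> 0 = 0" using \<phi>(1)[of 0 0] by simp
  have \<phi>_diff: "\<phi> (x - y) = \<phi> x - \<phi> y" for x y
    using \<phi>(1)[of "x - y" y] by simp
  have "commutative_unital_subalgebra sB (range \<phi>) (\<phi> 1)"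
  proof
    show "B.subspace (range \<phi>)"
    proof (rule B.subspaceI)
      show "0 \<in> range \<phi>" by (metis \<phi>0 rangeI)
    qed (auto simp flip: \<phi>(1,2))
  qed (auto simp flip: \<phi>(3) simp: A.property_P_commutative[OF assms(3)])
  then have C: "commutative_unital_subalgebra sB ?C (\<phi> 1)"
    by (rule B.commutative_unital_subalgebra_closure)
  interpret C: commutative_unital_subalgebra sB ?C "\<phi> 1" by (rule C)
  have \<phi>C: "\<phi> x \<in> ?C" for x using closure_subset[of "range \<phi>"] by auto
  obtain q \<epsilon> where q: "seminorm sB q" "submultiplicative q"
    and q_open: "\<And>x \<delta>. open {y. q (y - x) < \<delta>}" and \<epsilon>: "0 < \<epsilon>"
    and ball: "\<And>y. y \<in> ?C \<Longrightarrow> q y < \<epsilon> \<Longrightarrow> y \<in> quasi_invertibles ?C"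
    using B.Q_algebra_quasi_invertible_ball[OF assms(8) C.closed_intros(1)] by metis
  have q_mult: "q (x * y) \<le> q x * q y" for x y using q(2) by (simp add: submultiplicative_def)

  define F where "F = {f \<in> continuous_characters sA. \<forall>x. \<epsilon> * norm (f x) \<le> q (\<phi> x)}"
  have "F = continuous_characters sA"
  proof (rule ccontr)
    assume "F \<noteq> continuous_characters sA"
    \<comment> \<open>Evaluation at a point is continuous for pointwise convergence, so each
      inequality is a closed condition on \<open>f\<close>.\<close>
    moreover have "closed {f. \<forall>x. \<epsilon> * norm (f x) \<le> q (\<phi> x)}"
      by (intro closed_Collect_all closed_Collect_le continuous_intros continuous_on_product_coordinates)
    then have "closedin (top_of_set (continuous_characters sA)) F"
      using closedin_closed_Int by (auto simp: F_def Collect_conj_eq)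
    ultimately have "\<exists>x. x \<noteq> 0 \<and> (\<forall>f\<in>F. f x = 0)"
      using assms(2)[unfolded weakly_regular_def, rule_format, of F] by blast
    then obtain x where x: "x \<noteq> 0" "\<And>f. f \<in> F \<Longrightarrow> f x = 0" by auto
    have "\<phi> x \<in> I" if I: "maximal_left_ideal sB ?C I" for I
    proof -
      obtain g where g: "g (\<phi> 1) = 1"
        "\<And>x y. x \<in> ?C \<Longrightarrow> y \<in> ?C \<Longrightarrow> g (x + y) = g x + g y"
        "\<And>c x. x \<in> ?C \<Longrightarrow> g (sB c x) = c * g x"
        "\<And>x y. x \<in> ?C \<Longrightarrow> y \<in> ?C \<Longrightarrow> g (x * y) = g x * g y"
        "\<And>x. x \<in> ?C \<Longrightarrow> \<epsilon> * norm (g x) \<le> q x"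
        "\<And>x. x \<in> ?C \<Longrightarrow> g x = 0 \<Longrightarrow> x \<in> I"
        by (rule C.exists_character_of_maximal_left_ideal[OF q(1) q_mult \<epsilon> _ I])
          (rule ball that; assumption)+
      have "vector_space ((*) :: complex \<Rightarrow> complex \<Rightarrow> complex)"
        by unfold_locales (auto simp: algebra_simps)
      \<comment> \<open>The pullback is nonzero because \<open>g (\<phi> 1) = 1\<close>. Functional
        continuity makes it continuous, and the bound on \<open>g\<close> places it in
        \<open>F\<close>, so it kills \<open>x\<close>.\<close>
      then have "g \<circ> \<phi> \<in> characters sA"
        unfolding characters_def algebra_hom_iff
        using g(1) by (auto simp: \<phi> g \<phi>C A.vector_space_axioms intro!: exI[of _ 1])
      then have "g \<circ> \<phi> \<in> F"
        using assms(9) g(5) \<phi>C by (simp add: F_def functionally_continuous_def)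
      then have "g (\<phi> x) = 0" using x(2) by fastforce
      then show "\<phi> x \<in> I" using g(6) \<phi>C by blast
    qed
    \<comment> \<open>Lying in every maximal left ideal, \<open>\<phi> x\<close> is in the radical,
      so semisimplicity and injectivity force \<open>x = 0\<close>.\<close>
    then have "\<phi> x \<in> jacobson_radical sB ?C" using \<phi>C by (auto simp: jacobson_radical_def)
    then have "\<phi> x = \<phi> 0" using assms(7) by (simp add: semisimple_def \<phi>0)
    then show False using x(1) assms(6) by (simp add: inj_eq)
  qed
  then have char_bound: "\<epsilon> * norm (f x) \<le> q (\<phi> x)" if "f \<in> characters sA" for f x
    using that assms(9) by (auto simp: F_def functionally_continuous_def)
  have bound: "\<epsilon> * p s x \<le> q (\<phi> x)" if s: "s \<in> S" for s x
  proof -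
    obtain f where f: "f \<in> characters sA" "p s x \<le> norm (f x)"
      using A.property_P_dominates[OF assms(3) s A.seminorms[OF s]] by blast
    then have "\<epsilon> * p s x \<le> \<epsilon> * norm (f x)" using \<epsilon> by simp
    also have "\<dots> \<le> q (\<phi> x)" by (rule char_bound[OF f(1)])
    finally show ?thesis .
  qed

  show ?thesis
    unfolding continuous_on_topological
  proof (intro ballI allI impI)
    fix y U assume "y \<in> range \<phi>" and U: "open U" "inv \<phi> y \<in> U"
    then obtain a where y: "y = \<phi> a" by auto
    with U assms(6) have "a \<in> U" by simp
    then obtain G e where G: "finite G" "G \<subseteq> S" "0 < e" "{b. \<forall>s\<in>G. p s (b - a) < e} \<subseteq> U"
      using A.determined[unfolded topology_determined_by_def, rule_format, of U] U(1) by blast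
    \<comment> \<open>The radius \<open>\<epsilon> * e\<close> makes \<open>bound\<close>, applied
      to \<open>b - a\<close>, give \<open>p s (b - a) < e\<close> for every
      \<open>s \<in> G\<close>.\<close>
    have "b \<in> U" if b: "q (\<phi> b - \<phi> a) < \<epsilon> * e" for b
    proof -
      have "p s (b - a) < e" if "s \<in> G" for s
      proof -
        have "\<epsilon> * p s (b - a) < \<epsilon> * e" using bound[of s "b - a"] b that G(2) by (auto simp: \<phi>_diff)
        then show ?thesis using \<epsilon> by simp
      qed
      then show ?thesis using G(4) by auto
    qed
    then show "\<exists>V. open V \<and> y \<in> V \<and> (\<forall>z\<in>range \<phi>. z \<in> V \<longrightarrow> inv \<phi> z \<in> U)"
      using q_open[of y "\<epsilon> * e"] \<epsilon> G(3) assms(6) B.seminorm_zero[OF q(1)]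
      by (intro exI[of _ "{z. q (z - y) < \<epsilon> * e}"]) (auto simp: y)
  qed
qed

end
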